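(* Let $M>\frac23$ and $\alpha\in\mathbb{R}$. If $(\lambda_1,\lambda_2,\lambda_3)\in(0,\infty)^3$ satisfies $T_i(\lambda_1,\lambda_2,\lambda_3)=\alpha$ for $i=1,2,3$, where $T_i$ are the principal Biot stresses of the Neo-Hooke-Ciarlet-Geymonat material with parameter $M$, then at least two of the numbers $\lambda_1,\lambda_2,\lambda_3$ are equal. In other words, the equation $T_{\rm Biot}(U)=\alpha\,\mathbb{1}$ has no solution $U\in\mathrm{Sym}^{++}(3)$ with three pairwise distinct eigenvalues.
   Context: $\mathrm{Sym}^{++}(3)$ is the set of real symmetric positive definite $3\times3$ matrices, $\mathbb{1}$ the $3\times3$ identity matrix. For $M>\frac23$, the Biot stress tensor of the (one-parameter) Neo-Hooke-Ciarlet-Geymonat material is $$T_{\rm Biot}(U)=U+\Big[\Big(\tfrac M2-\tfrac13\Big)\Big(\det U-\tfrac1{\det U}\Big)-\tfrac1{\det U}\Big](\det U)\,U^{-1},\qquad U\in\mathrm{Sym}^{++}(3),$$ and its principal values, in terms of the eigenvalues $\lambda_1,\lambda_2,\lambda_3>0$ of $U$, are the principal Biot stresses $$T_i(\lambda_1,\lambda_2,\lambda_3)=\lambda_i-\frac1{\lambda_i}+\Big(\frac M2-\frac13\Big)\Big(\frac{\lambda_1^2\lambda_2^2\lambda_3^2}{\lambda_i}-\frac1{\lambda_i}\Big),\qquad i=1,2,3.$$ *)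

theory Defs
  imports "HOL-Analysis.Analysis"
begin

definition Sym_pos_def :: "(real ^ 'n ^ 'n) set" where
  "Sym_pos_def = {U. transpose U = U \<and> (\<forall>v. v \<noteq> 0 \<longrightarrow> v \<bullet> (U *v v) > 0)}"

definition eigenvalue :: "real ^ 'n ^ 'n \<Rightarrow> real \<Rightarrow> bool" where
  "eigenvalue A c \<longleftrightarrow> (\<exists>v. v \<noteq> 0 \<and> A *v v = c *\<^sub>R v)"

(* Only meaningful on Sym_pos_def, where det U > 0 and U is invertible. *)
definition T_Biot :: "real \<Rightarrow> real ^ 3 ^ 3 \<Rightarrow> real ^ 3 ^ 3" where
  "T_Biot M U = U + (((M / 2 - 1 / 3) * (det U - 1 / det U) - 1 / det U) * det U) *\<^sub>R matrix_inv U"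

(* The index type 3 has exactly the elements 1, 2, 3 (the last of which also reads 0). *)
definition principal_Biot_stress :: "real \<Rightarrow> real ^ 3 \<Rightarrow> 3 \<Rightarrow> real" where
  "principal_Biot_stress M l i =
     l $ i - 1 / l $ i
       + (M / 2 - 1 / 3) * ((l $ 1)\<^sup>2 * (l $ 2)\<^sup>2 * (l $ 3)\<^sup>2 / l $ i - 1 / l $ i)"

end

(* Multiplying T_i = alpha by lambda_i shows that all principal stretches are roots of one and
   the same monic quadratic polynomial; likewise the eigenvalues of U, because
   T_Biot(U) = U + s U^{-1} for a scalar s. A quadratic has at most two roots. *)
theory Submission
  imports Defs
begin

text \<open>Subtracting two of the equations gives a factorization such as
  \<open>(a - b) * (a + b - p) = 0\<close>, so two distinct roots sum to \<open>p\<close>, as in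
  Vieta's formulas. If \<open>b\<close> differs from both \<open>a\<close> and \<open>c\<close>,
  then each of these equals \<open>p - b\<close>.\<close>

lemma monic_quadratic_three_roots:
  fixes a b c p q :: "'a::idom"
  assumes "a\<^sup>2 + q = p * a" "b\<^sup>2 + q = p * b" "c\<^sup>2 + q = p * c"
  shows "a = b \<or> b = c \<or> a = c"
proof (rule ccontr)
  assume ne: "\<not> (a = b \<or> b = c \<or> a = c)"
  have "(a - b) * (a + b - p) = 0" "(b - c) * (b + c - p) = 0"
    using assms by algebra+
  with ne have "a + b - p = 0" "b + c - p = 0"
    by auto
  then have "a = c"
    by algebra
  with ne show False
    by simp
qed

text \<open>Multiplying by \<open>l $ i\<close> clears all denominators. The constant term that
  remains is symmetric in the stretches, hence the same for every \<open>i\<close>.\<close>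

lemma principal_Biot_stress_quadratic:
  assumes "l $ i > 0" "principal_Biot_stress M l i = \<alpha>"
  shows "(l $ i)\<^sup>2 + ((M / 2 - 1 / 3) * ((l $ 1)\<^sup>2 * (l $ 2)\<^sup>2 * (l $ 3)\<^sup>2 - 1) - 1) = \<alpha> * l $ i"
proof -
  define P where "P = (l $ 1)\<^sup>2 * (l $ 2)\<^sup>2 * (l $ 3)\<^sup>2"
  define x where "x = l $ i"
  have "x \<noteq> 0" and \<alpha>: "\<alpha> = x - 1 / x + (M / 2 - 1 / 3) * (P / x - 1 / x)"
    using assms unfolding principal_Biot_stress_def P_def x_def by auto
  from \<open>x \<noteq> 0\<close> have "\<alpha> * x = x\<^sup>2 + ((M / 2 - 1 / 3) * (P - 1) - 1)"
    unfolding \<alpha> by (simp add: field_simps power2_eq_square)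
  then show ?thesis
    by (simp add: P_def x_def)
qed

text \<open>A nonzero kernel vector \<open>v\<close> would give
  \<open>v \<bullet> (U *v v) = 0\<close>, against positivity; for a square matrix a trivial kernel
  suffices.\<close>

lemma Sym_pos_def_invertible:
  assumes "U \<in> Sym_pos_def"
  shows "invertible U"
proof -
  have "v = 0" if "U *v v = 0" for v
    using assms that unfolding Sym_pos_def_def by force
  then show ?thesis
    using invertible_left_inverse matrix_left_invertible_ker by blast
qed

lemma eigenvalue_quadratic:
  fixes U :: "real ^ 'n ^ 'n"
  assumes "invertible U" "U + s *\<^sub>R matrix_inv U = \<alpha> *\<^sub>R mat 1" "eigenvalue U a"
  shows "a\<^sup>2 + s = \<alpha> * a"
proof -
  obtain v where v: "v \<noteq> 0" "U *v v = a *\<^sub>R v"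
    using assms(3) unfolding eigenvalue_def by blast
  \<comment> \<open>\<open>matrix_inv\<close> is a Hilbert choice; invertibility supplies the
    witness that makes its defining property available.\<close>
  have "matrix_inv U ** U = mat 1"
    using assms(1) unfolding matrix_inv_def invertible_def by (rule someI2_ex) simp
  then have inv: "matrix_inv U *v (a *\<^sub>R v) = v"
    by (simp add: matrix_vector_mul_assoc flip: v(2))
  \<comment> \<open>The matrix identity is evaluated at \<open>U *v v\<close>, that is at
    \<open>a\<close> times \<open>v\<close>, rather than at \<open>v\<close>: the inverse then
    returns \<open>v\<close> with no division by \<open>a\<close>.\<close>
  have "(a\<^sup>2 + s) *\<^sub>R v = U *v (a *\<^sub>R v) + s *\<^sub>R (matrix_inv U *v (a *\<^sub>R v))"
    unfolding inv by (simp add: v(2) matrix_vector_mult_scaleR scaleR_add_left power2_eq_square)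
  also have "\<dots> = (U + s *\<^sub>R matrix_inv U) *v (a *\<^sub>R v)"
    by (simp add: matrix_vector_mult_add_rdistrib scaleR_matrix_vector_assoc)
  also have "\<dots> = (\<alpha> * a) *\<^sub>R v"
    unfolding assms(2) by (simp flip: scaleR_matrix_vector_assoc)
  finally show ?thesis
    using v(1) by simp
qed

theorem mainTheorem7:
  fixes M \<alpha> :: real
  assumes "M > 2 / 3"
  shows "(\<forall>l :: real ^ 3. (\<forall>i. l $ i > 0) \<and> (\<forall>i. principal_Biot_stress M l i = \<alpha>)
            \<longrightarrow> l $ 1 = l $ 2 \<or> l $ 2 = l $ 3 \<or> l $ 1 = l $ 3)
       \<and> \<not> (\<exists>U \<in> Sym_pos_def. T_Biot M U = \<alpha> *\<^sub>R mat 1 \<and>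
              (\<exists>a b c. eigenvalue U a \<and> eigenvalue U b \<and> eigenvalue U c
                 \<and> a \<noteq> b \<and> b \<noteq> c \<and> a \<noteq> c))"
proof (intro conjI allI impI notI)
  fix l :: "real ^ 3"
  assume "(\<forall>i. l $ i > 0) \<and> (\<forall>i. principal_Biot_stress M l i = \<alpha>)"
  then show "l $ 1 = l $ 2 \<or> l $ 2 = l $ 3 \<or> l $ 1 = l $ 3"
    using monic_quadratic_three_roots[OF principal_Biot_stress_quadratic
        principal_Biot_stress_quadratic principal_Biot_stress_quadratic]
    by blast
next
  assume "\<exists>U \<in> Sym_pos_def. T_Biot M U = \<alpha> *\<^sub>R mat 1 \<and>
              (\<exists>a b c. eigenvalue U a \<and> eigenvalue U b \<and> eigenvalue U c
                 \<and> a \<noteq> b \<and> b \<noteq> c \<and> a \<noteq> c)"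
  then obtain U a b c where U: "U \<in> Sym_pos_def" "T_Biot M U = \<alpha> *\<^sub>R mat 1"
    and ev: "eigenvalue U a" "eigenvalue U b" "eigenvalue U c"
    and ne: "a \<noteq> b" "b \<noteq> c" "a \<noteq> c"
    by blast
  \<comment> \<open>Unfolding \<open>T_Biot\<close> identifies \<open>s\<close> with the scalar
    factor of \<open>matrix_inv U\<close>. It depends only on \<open>M\<close> and \<open>U\<close>,
    so all three eigenvalues satisfy the same quadratic.\<close>
  note quadratic = eigenvalue_quadratic[OF Sym_pos_def_invertible[OF U(1)] U(2)[unfolded T_Biot_def]]
  show False
    using monic_quadratic_three_roots[OF ev[THEN quadratic]] ne by blast
qed

end
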